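(* For every real $\alpha>0$ and every integer $d\ge 2$, there exists an integer $k\ge 1$ such that the $\mathrm{GN}_k(d,\alpha)$ model percolates on $\mathbb{R}^d$.
   Context: Let $X$ be a homogeneous Poisson process on $\mathbb{R}^d$ (of some positive, finite density; the choice of density only rescales the model). For $x\in X$ let $d_i(x)$ be the Euclidean distance from $x$ to its $i$th nearest neighbour among the other points of $X$. For an integer $k\ge 1$ and a real $\alpha\ge 0$, the model $\mathrm{GN}_k(d,\alpha)$ is the random undirected graph with vertex set $X$ in which each $x\in X$ is joined by an edge to every $y\in X$ with $y\ne x$ and $|x-y|\le r(x)$, where $r(x)=\alpha d_k(x)$ (so $x,y$ are adjacent iff $|x-y|\le r(x)$ or $|x-y|\le r(y)$). (This is the model with connection range $r(x)=\sum_i\alpha_i d_i(x)$ where $\alpha_k=\alpha$ and all other $\alpha_i$ are $0$.) The model percolates if the event $U$ that the graph has an infinite connected component has positive probability (equivalently, by ergodicity, probability $1$). *)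

theory Defs
  imports "HOL-Probability.Probability"
begin

subsection \<open>Homogeneous Poisson processes\<close>

definition configurations :: "'a::euclidean_space set set" where
  "configurations = {S. \<forall>B. bounded B \<longrightarrow> finite (S \<inter> B)}"

definition bounded_borel :: "'a::euclidean_space set set" where
  "bounded_borel = {B \<in> sets borel. bounded B}"

definition points_in :: "'a set \<Rightarrow> 'a set \<Rightarrow> nat" where
  "points_in B S = card (S \<inter> B)"

text \<open>The sigma-algebra generated by the counting maps of bounded Borel sets.\<close>

definition configuration_space :: "'a::euclidean_space set measure" where
  "configuration_space = sigma configurations
     {{S \<in> configurations. points_in B S = n} | B n. B \<in> bounded_borel}"

text \<open>A homogeneous Poisson process enters through its law \<open>P\<close> on the space of configurations,
  i.e. the process is the identity map on that space. A process on some other probability space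
  is covered by the image measure.\<close>

definition poisson_process_law :: "real \<Rightarrow> 'a::euclidean_space set measure \<Rightarrow> bool" where
  "poisson_process_law \<rho> P \<longleftrightarrow>
     prob_space P \<and>
     sets P = sets configuration_space \<and>
     (\<forall>B\<in>bounded_borel. \<forall>n.
        measure P {S \<in> space P. points_in B S = n} =
          (\<rho> * measure lborel B) ^ n / fact n * exp (- (\<rho> * measure lborel B))) \<and>
     (\<forall>\<B>. finite \<B> \<and> \<B> \<subseteq> bounded_borel \<and> disjoint \<B> \<longrightarrow>
        prob_space.indep_vars P (\<lambda>_. count_space UNIV) points_in \<B>)"

subsection \<open>The random geometric graph\<close>

text \<open>The distance \<open>d\<^sub>k(x)\<close> from \<open>x\<close> to its \<open>k\<close>-th nearest neighbour among the other points
  of \<open>S\<close>, where equidistant points are counted separately. If \<open>S\<close> has fewer than \<open>k\<close> points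
  other than \<open>x\<close>, the value is unspecified; a configuration of a Poisson process of positive
  density is almost surely infinite.\<close>

definition nn_dist :: "'a::metric_space set \<Rightarrow> nat \<Rightarrow> 'a \<Rightarrow> real" where
  "nn_dist S k x = Inf {r. 0 \<le> r \<and> k \<le> card {y \<in> S - {x}. dist x y \<le> r}}"

definition GN_edges :: "nat \<Rightarrow> real \<Rightarrow> 'a::metric_space set \<Rightarrow> ('a \<times> 'a) set" where
  "GN_edges k \<alpha> S = {(x, y). x \<in> S \<and> y \<in> S \<and> x \<noteq> y \<and>
     (dist x y \<le> \<alpha> * nn_dist S k x \<or> dist x y \<le> \<alpha> * nn_dist S k y)}"

text \<open>For the symmetric edge relation \<open>E\<close>, the connected component of the vertex \<open>x\<close> is its
  image under the reflexive transitive closure of \<open>E\<close>.\<close>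

definition infinite_component :: "'a set \<Rightarrow> ('a \<times> 'a) set \<Rightarrow> bool" where
  "infinite_component S E \<longleftrightarrow> (\<exists>x\<in>S. infinite (E\<^sup>* `` {x}))"

text \<open>The model percolates for every density. As \<open>measure\<close> vanishes on non-measurable sets,
  the inequality includes the measurability of the percolation event.\<close>

definition GN_percolates :: "'a::euclidean_space itself \<Rightarrow> nat \<Rightarrow> real \<Rightarrow> bool" where
  "GN_percolates _ k \<alpha> \<longleftrightarrow>
     (\<forall>\<rho>>0. \<forall>P :: 'a set measure. poisson_process_law \<rho> P \<longrightarrow>
        0 < measure P {S \<in> space P. infinite_component S (GN_edges k \<alpha> S)})"

end

theory Submission
  imports Defs "HOL-Library.Transitive_Closure_Table"
begin

text \<open>Place sites \<open>c u\<close>, \<open>u \<in> \<nat> \<times> \<nat>\<close>, on a square lattice of mesh \<open>s\<close> in a coordinate plane, and let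
  \<open>R = 1/2 + 2/\<alpha>\<close>. Call \<open>u\<close> good if the ball of radius \<open>s/2\<close> around \<open>c u\<close> contains a point of the process
  and the ball of radius \<open>R s\<close> contains fewer than \<open>k\<close>. Points \<open>x\<close>, \<open>y\<close> in the small balls of
  neighbouring good sites have distance less than \<open>2 s\<close>, so fewer than \<open>k\<close> points lie within
  \<open>dist x y / \<alpha>\<close> of \<open>x\<close>, whence \<open>x\<close> and \<open>y\<close> are adjacent. Taking first the mean number of points in
  the small ball and then \<open>k\<close> large makes bad sites as rare as desired, uniformly in the density,
  and sites at lattice distance at least \<open>2 R\<close> are independent. A Peierls argument in the quadrant
  then gives an infinite cluster of good sites with positive probability.\<close>

subsection \<open>Finite clusters in the quadrant\<close>

definition nbr :: "((nat \<times> nat) \<times> (nat \<times> nat)) set" where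
  "nbr = {((a, b), (c, d)). a = c \<and> (d = Suc b \<or> b = Suc d) \<or> b = d \<and> (c = Suc a \<or> a = Suc c)}"

text \<open>Diagonal steps are allowed because the boundary of a cluster connected through
  \<open>nbr\<close> is in general connected only in this weaker sense. The relation is reflexive,
  hence the bound 9 on the number of neighbours.\<close>

definition star_nbr :: "nat \<times> nat \<Rightarrow> nat \<times> nat \<Rightarrow> bool" where
  "star_nbr p q \<longleftrightarrow> fst q \<le> Suc (fst p) \<and> fst p \<le> Suc (fst q) \<and> snd q \<le> Suc (snd p) \<and> snd p \<le> Suc (snd q)"

text \<open>Only sites of the quadrant occur, so nothing beyond the axes counts as boundary. Sites
  in holes of \<open>C\<close> are included.\<close>

definition outer_boundary :: "(nat \<times> nat) set \<Rightarrow> (nat \<times> nat) set" where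
  "outer_boundary C = {p. p \<notin> C \<and> (\<exists>c\<in>C. (c, p) \<in> nbr)}"

lemma dual_path:
  assumes fin: "finite C" and origin: "(0, 0) \<in> C"
  defines "B \<equiv> outer_boundary C"
  obtains a b where "(a, 0) \<in> B" "(\<lambda>p q. star_nbr p q \<and> q \<in> B)\<^sup>*\<^sup>* (a, 0) (0, b)"
proof (rule ccontr)
  text \<open>\<open>D\<close> collects the boundary sites reachable from the horizontal axis. The unit edges of the
    dual lattice separating \<open>C\<close> from \<open>D\<close> form a graph with all degrees even, since the boundary
    sites in a two by two block are mutually \<open>star_nbr\<close> and hence all in \<open>D\<close> or all outside. So the
    parity \<open>f\<close> of the number of such edges crossed by a rightward ray changes exactly across
    these edges. It is odd at the origin and even far up the vertical axis, although no such edge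
    crosses that axis when \<open>D\<close> misses it.\<close>
  let ?R = "\<lambda>p q. star_nbr p q \<and> q \<in> B"
  assume "\<not> thesis"
  with that have no: "(a, 0) \<in> B \<Longrightarrow> \<not> ?R\<^sup>*\<^sup>* (a, 0) (0, b)" for a b
    by blast
  define D where "D = {q \<in> B. \<exists>a. (a, 0) \<in> B \<and> ?R\<^sup>*\<^sup>* (a, 0) q}"
  have D_closed: "q \<in> D" if "p \<in> D" "star_nbr p q" "q \<in> B" for p q
    using that unfolding D_def by (auto intro: rtranclp.rtrancl_into_rtrancl)
  have D_B: "p \<in> B" if "p \<in> D" for p
    using that by (simp add: D_def)
  have B_C: "p \<notin> C" if "p \<in> B" for p
    using that by (simp add: B_def outer_boundary_def)
  have B_I: "q \<in> B" if "p \<in> C" "q \<notin> C" "(p, q) \<in> nbr" for p q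
    using that by (auto simp: B_def outer_boundary_def)
  have D_axis: "(i, 0) \<in> D" if "(i, 0) \<in> B" for i
    using that by (auto simp: D_def)
  have D_left: "(0, j) \<notin> D" for j
    using no by (auto simp: D_def)
  define sep where "sep p q \<longleftrightarrow> p \<in> C \<and> q \<in> D \<or> q \<in> C \<and> p \<in> D" for p q
  define h where "h i j \<longleftrightarrow> sep (i, j) (Suc i, j)" for i j
  define v where "v i j \<longleftrightarrow> sep (i, j) (i, Suc j)" for i j
  have even_degree: "(h i j \<noteq> h i (Suc j)) = (v i j \<noteq> v (Suc i) j)" for i j
  proof -
    let ?p = "(i, j)" and ?q = "(Suc i, j)" and ?r = "(Suc i, Suc j)" and ?t = "(i, Suc j)"
    have adj: "(?p, ?q) \<in> nbr" "(?q, ?p) \<in> nbr" "(?q, ?r) \<in> nbr" "(?r, ?q) \<in> nbr"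
      "(?r, ?t) \<in> nbr" "(?t, ?r) \<in> nbr" "(?t, ?p) \<in> nbr" "(?p, ?t) \<in> nbr"
      by (auto simp: nbr_def)
    have B1: "?p \<in> C \<Longrightarrow> ?q \<notin> C \<Longrightarrow> ?q \<in> B" "?q \<in> C \<Longrightarrow> ?p \<notin> C \<Longrightarrow> ?p \<in> B"
      "?q \<in> C \<Longrightarrow> ?r \<notin> C \<Longrightarrow> ?r \<in> B" "?r \<in> C \<Longrightarrow> ?q \<notin> C \<Longrightarrow> ?q \<in> B"
      "?r \<in> C \<Longrightarrow> ?t \<notin> C \<Longrightarrow> ?t \<in> B" "?t \<in> C \<Longrightarrow> ?r \<notin> C \<Longrightarrow> ?r \<in> B"
      "?t \<in> C \<Longrightarrow> ?p \<notin> C \<Longrightarrow> ?p \<in> B" "?p \<in> C \<Longrightarrow> ?t \<notin> C \<Longrightarrow> ?t \<in> B"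
      using adj B_I by blast+
    have star: "star_nbr x y" if "x \<in> {?p, ?q, ?r, ?t}" "y \<in> {?p, ?q, ?r, ?t}" for x y
      using that by (auto simp: star_nbr_def)
    show ?thesis
    proof (cases "\<exists>x\<in>{?p, ?q, ?r, ?t}. x \<in> D")
      case True
      then obtain x where x: "x \<in> {?p, ?q, ?r, ?t}" "x \<in> D" by blast
      have "y \<in> D \<longleftrightarrow> y \<in> B" if "y \<in> {?p, ?q, ?r, ?t}" for y
        using D_closed[OF x(2) star[OF x(1) that]] D_B by blast
      then have "?p \<in> D \<longleftrightarrow> ?p \<in> B" "?q \<in> D \<longleftrightarrow> ?q \<in> B" "?r \<in> D \<longleftrightarrow> ?r \<in> B" "?t \<in> D \<longleftrightarrow> ?t \<in> B"
        by simp_all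
      then show ?thesis
        unfolding h_def v_def sep_def using B1 B_C by metis
    next
      case False
      then show ?thesis
        by (simp add: h_def v_def sep_def)
    qed
  qed
  obtain N where N: "i < N \<and> j < N" if "(i, j) \<in> C" for i j
  proof -
    obtain N1 where N1: "\<forall>i\<in>fst ` C. i < N1"
      using fin finite_nat_set_iff_bounded by (metis finite_imageI)
    obtain N2 where N2: "\<forall>i\<in>snd ` C. i < N2"
      using fin finite_nat_set_iff_bounded by (metis finite_imageI)
    show thesis
      by (rule that[of "max N1 N2"]) (use N1 N2 in force)
  qed
  have D_near: "i \<le> N \<and> j \<le> N" if ij: "(i, j) \<in> D" for i j
  proof -
    obtain c where "c \<in> C" "(c, (i, j)) \<in> nbr"
      using D_B[OF ij] by (auto simp: B_def outer_boundary_def)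
    moreover obtain i' j' where "c = (i', j')"
      by fastforce
    ultimately show ?thesis
      using N[of i' j'] by (auto simp: nbr_def)
  qed
  \<comment> \<open>A separating horizontal edge has an endpoint in \<open>C\<close>, hence starts
    left of column \<open>N\<close>. The cut-off at \<open>N\<close> loses none of them and keeps
    the count finite.\<close>
  define f where "f i j \<longleftrightarrow> odd (card {i'. i \<le> i' \<and> i' \<le> N \<and> h i' j})" for i j
  have f_far: "\<not> f (Suc N) j" for j
  proof -
    have "{i'. Suc N \<le> i' \<and> i' \<le> N \<and> h i' j} = {}"
      by auto
    show ?thesis
      unfolding f_def \<open>_ = {}\<close> by simp
  qed
  have f_step: "f i j \<longleftrightarrow> h i j \<noteq> f (Suc i) j" if "i \<le> N" for i j
  proof -
    have eq: "{i'. i \<le> i' \<and> i' \<le> N \<and> h i' j} =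
        (if h i j then insert i {i'. Suc i \<le> i' \<and> i' \<le> N \<and> h i' j}
         else {i'. Suc i \<le> i' \<and> i' \<le> N \<and> h i' j})"
      using that by (auto simp: le_eq_less_or_eq)
    have "finite {i'. Suc i \<le> i' \<and> i' \<le> N \<and> h i' j}"
      by (rule finite_subset[of _ "{..N}"]) auto
    then show ?thesis
      unfolding f_def eq by simp
  qed
  \<comment> \<open>Downward induction from column \<open>Suc N\<close>, where both sides are false.
    Moving one column to the left changes both sides alike, by \<open>even_degree\<close>.\<close>
  have f_v: "(f i j \<noteq> f i (Suc j)) = v i j" if "i \<le> Suc N" for i j
    using that
  proof (induction rule: inc_induct)
    case base
    have "\<not> v (Suc N) j"
      using N D_near by (fastforce simp: v_def sep_def)
    then show ?case
      using f_far by simp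
  next
    case (step i)
    then show ?case
      using f_step[of i j] f_step[of i "Suc j"] even_degree[of i j] by auto
  qed
  have f_axis: "f i 0 \<longleftrightarrow> (i, 0) \<in> C" if "i \<le> Suc N" for i
    using that
  proof (induction rule: inc_induct)
    case base
    then show ?case
      using f_far N by force
  next
    case (step i)
    have adj: "((i, 0), (Suc i, 0)) \<in> nbr" "((Suc i, 0), (i, 0)) \<in> nbr"
      by (auto simp: nbr_def)
    \<comment> \<open>On the horizontal axis every boundary site belongs to \<open>D\<close>, so
      each passage into or out of \<open>C\<close> is a separating edge.\<close>
    have "h i 0 \<longleftrightarrow> (((i, 0) \<in> C) \<noteq> ((Suc i, 0) \<in> C))"
      unfolding h_def sep_def using adj B_I D_axis D_B B_C by metis
    then show ?case
      using step f_step[of i 0] by auto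
  qed
  have "f 0 j" for j
  proof (induction j)
    case 0
    then show ?case using f_axis origin by simp
  next
    case (Suc j)
    have "\<not> v 0 j"
      using D_left by (simp add: v_def sep_def)
    with f_v[of 0 j] Suc show ?case by simp
  qed
  moreover have "\<not> f 0 (Suc N)"
  proof -
    have "\<not> h i (Suc N)" for i
      using N D_near by (fastforce simp: h_def sep_def)
    then show ?thesis by (simp add: f_def)
  qed
  ultimately show False by blast
qed

section \<open>Counting paths of star-neighbours\<close>

lemma rtrancl_path_star_nbr_fst_le:
  "rtrancl_path star_nbr p xs q \<Longrightarrow> fst p \<le> fst q + length xs"
  by (induction rule: rtrancl_path.induct) (auto simp: star_nbr_def)

text \<open>As in \<open>rtrancl_path\<close>, the list omits the start \<open>p\<close>, so a list
  of length \<open>n\<close> together with \<open>p\<close> gives \<open>n + 1\<close>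
  sites.\<close>

definition star_paths :: "nat \<times> nat \<Rightarrow> nat \<Rightarrow> (nat \<times> nat) list set" where
  "star_paths p n = {xs. length xs = n \<and> (\<exists>q. rtrancl_path star_nbr p xs q)}"

lemma star_nbrs: "finite {q. star_nbr p q}" "card {q. star_nbr p q} \<le> 9"
proof -
  have sub: "{q. star_nbr p q} \<subseteq> {fst p - 1..fst p + 1} \<times> {snd p - 1..snd p + 1}"
    by (auto simp: star_nbr_def)
  show "finite {q. star_nbr p q}"
    by (rule finite_subset[OF sub]) simp
  have "card {q. star_nbr p q} \<le> card ({fst p - 1..fst p + 1} \<times> {snd p - 1..snd p + 1})"
    by (rule card_mono[OF _ sub]) simp
  also have "\<dots> = card {fst p - 1..fst p + 1} * card {snd p - 1..snd p + 1}"
    by (rule card_cartesian_product)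
  also have "\<dots> \<le> 3 * 3"
    by (rule mult_le_mono) auto
  finally show "card {q. star_nbr p q} \<le> 9" by simp
qed

lemma star_paths_Suc:
  "star_paths p (Suc n) = (\<Union>q\<in>{q. star_nbr p q}. (#) q ` star_paths q n)" (is "?L = ?R")
proof
  show "?L \<subseteq> ?R"
    by (auto simp: star_paths_def length_Suc_conv elim!: rtrancl_path.cases[of _ _ "_ # _"])
  show "?R \<subseteq> ?L"
    by (auto simp: star_paths_def intro: rtrancl_path.step)
qed

lemma star_paths: "finite (star_paths p n)" "card (star_paths p n) \<le> 9 ^ n"
proof (induction n arbitrary: p)
  case 0
  have eq: "star_paths p 0 = {[]}" for p
    using rtrancl_path.base[of star_nbr p] unfolding star_paths_def by blast
  case 1 show ?case by (simp add: eq)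
  case 2 show ?case by (simp add: eq)
next
  case (Suc n)
  case 1 show ?case
    using Suc star_nbrs by (simp add: star_paths_Suc)
  case 2
  have "card (star_paths p (Suc n)) \<le> (\<Sum>q\<in>{q. star_nbr p q}. card ((#) q ` star_paths q n))"
    unfolding star_paths_Suc by (rule card_UN_le) (rule star_nbrs)
  also have "\<dots> \<le> (\<Sum>q\<in>{q. star_nbr p q}. 9 ^ n)"
    by (rule sum_mono) (use Suc card_image_le order_trans in blast)
  also have "\<dots> \<le> 9 * 9 ^ n"
    using star_nbrs(2)[of p] by simp
  finally show ?case by simp
qed

text \<open>A neighbour of the cluster lying in \<open>G\<close> would belong to the cluster, so the
  boundary path of \<open>dual_path\<close> runs through the complement of \<open>G\<close>.
  Removing loops makes its \<open>n + 1\<close> sites distinct, and the probability bound is a power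
  of the number of distinct sites.\<close>

lemma finite_cluster_bad_path:
  assumes origin: "(0, 0) \<in> G" and fin: "finite ((Restr nbr G)\<^sup>* `` {(0, 0)})"
  obtains n a xs where "a \<le> n" "xs \<in> star_paths (a, 0) n"
    "distinct ((a, 0) # xs)" "set ((a, 0) # xs) \<subseteq> - G"
proof -
  define C where "C = (Restr nbr G)\<^sup>* `` {(0, 0)}"
  have C_G: "C \<subseteq> G"
  proof
    fix p assume "p \<in> C"
    then have "((0, 0), p) \<in> (Restr nbr G)\<^sup>*" by (simp add: C_def)
    then show "p \<in> G" by cases (auto simp: origin)
  qed
  have bdry: "outer_boundary C \<subseteq> - G"
  proof
    fix p assume "p \<in> outer_boundary C"
    then obtain c where c: "c \<in> C" "(c, p) \<in> nbr" "p \<notin> C"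
      by (auto simp: outer_boundary_def)
    show "p \<in> - G"
    proof
      assume "p \<in> G"
      then have "(c, p) \<in> Restr nbr G" using c C_G by auto
      then have "p \<in> C" using c(1) by (auto simp: C_def intro: rtrancl_into_rtrancl)
      then show False using c by simp
    qed
  qed
  have "finite C" "(0, 0) \<in> C"
    using fin by (auto simp: C_def)
  from dual_path[OF this] obtain a b where ab: "(a, 0) \<in> outer_boundary C"
    "(\<lambda>p q. star_nbr p q \<and> q \<in> outer_boundary C)\<^sup>*\<^sup>* (a, 0) (0, b)" .
  from ab(2) obtain xs0 where
    "rtrancl_path (\<lambda>p q. star_nbr p q \<and> q \<in> outer_boundary C) (a, 0) xs0 (0, b)"
    by (auto simp: rtranclp_eq_rtrancl_path)
  then obtain xs where xs:
    "rtrancl_path (\<lambda>p q. star_nbr p q \<and> q \<in> outer_boundary C) (a, 0) xs (0, b)" "distinct ((a, 0) # xs)"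
    by (rule rtrancl_path_distinct) blast
  have star: "rtrancl_path star_nbr p ys q \<and> set ys \<subseteq> outer_boundary C"
    if "rtrancl_path (\<lambda>p q. star_nbr p q \<and> q \<in> outer_boundary C) p ys q" for p ys q
    using that by induction (auto intro: rtrancl_path.intros)
  show thesis
  proof (rule that)
    \<comment> \<open>The path ends on the vertical axis and its first coordinate drops by at most
      one per step. This leaves only \<open>n + 1\<close> starting points for paths of length
      \<open>n\<close>.\<close>
    show "a \<le> length xs"
      using rtrancl_path_star_nbr_fst_le[of "(a, 0)" xs "(0, b)"] star[OF xs(1)] by simp
    show "xs \<in> star_paths (a, 0) (length xs)"
      using star[OF xs(1)] by (auto simp: star_paths_def)
    show "distinct ((a, 0) # xs)" by fact
    show "set ((a, 0) # xs) \<subseteq> - G"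
      using star[OF xs(1)] ab(1) bdry by auto
  qed
qed

subsection \<open>The Peierls bound\<close>

text \<open>A union bound: there are at most \<open>(n + 1) * 9 ^ n\<close> candidate paths of
  length \<open>n\<close>, each bad throughout with probability at most
  \<open>(1/36) ^ (n + 1)\<close>. As \<open>n + 1 \<le> 2 ^ n\<close> and 36 is 2 times 2 times 9,
  the sum over \<open>n\<close> is at most 1/18. Together with 1/36 for a bad origin, the failure
  probability stays below 1.\<close>

lemma (in prob_space) peierls:
  fixes Bad :: "nat \<times> nat \<Rightarrow> 'a set"
  assumes Bad: "\<And>u. Bad u \<in> events"
    and bound: "\<And>T. finite T \<Longrightarrow> T \<noteq> {} \<Longrightarrow> prob (\<Inter>u\<in>T. Bad u) \<le> (1/36) ^ card T"
    and A: "A \<in> events"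
    and imp: "\<And>\<omega>. \<omega> \<in> space M \<Longrightarrow> \<omega> \<notin> Bad (0, 0) \<Longrightarrow>
      infinite ((Restr nbr {u. \<omega> \<notin> Bad u})\<^sup>* `` {(0, 0)}) \<Longrightarrow> \<omega> \<in> A"
  shows "prob A > 0"
proof -
  define Pi where "Pi n = (SIGMA a:{..n}. {xs \<in> star_paths (a, 0) n. distinct ((a, 0) # xs)})" for n
  define V where "V p = (case p of (a, xs) \<Rightarrow> \<Inter>u\<in>set ((a::nat, 0::nat) # xs). Bad u)" for p
  define W where "W n = (\<Union>p\<in>Pi n. V p)" for n
  have finPi: "finite (Pi n)" for n
    unfolding Pi_def using star_paths by (auto intro!: finite_SigmaI)
  have cardPi: "card (Pi n) \<le> Suc n * 9 ^ n" for n
  proof -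
    have "card (Pi n) = (\<Sum>a\<le>n. card {xs \<in> star_paths (a, 0) n. distinct ((a, 0) # xs)})"
      unfolding Pi_def using star_paths by (subst card_SigmaI) auto
    also have "\<dots> \<le> (\<Sum>a\<le>n. 9 ^ n)"
    proof (rule sum_mono)
      fix a
      have "card {xs \<in> star_paths (a, 0) n. distinct ((a, 0) # xs)} \<le> card (star_paths (a, 0) n)"
        by (rule card_mono) (use star_paths in auto)
      then show "card {xs \<in> star_paths (a, 0) n. distinct ((a, 0) # xs)} \<le> 9 ^ n"
        using star_paths(2) order_trans by blast
    qed
    finally show ?thesis by simp
  qed
  have "(\<Inter>u\<in>set ((a, 0) # xs). Bad u) \<in> events" for a xs
    by (rule sets.finite_INT) (use Bad in auto)
  then have V_ev: "V p \<in> events" for p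
    unfolding V_def by (cases p) simp
  have V_prob: "prob (V p) \<le> (1/36) ^ Suc n" if "p \<in> Pi n" for p n
  proof -
    obtain a xs where p: "p = (a, xs)" "xs \<in> star_paths (a, 0) n" "distinct ((a, 0) # xs)"
      using \<open>p \<in> Pi n\<close> by (auto simp: Pi_def)
    have "card (set ((a, 0) # xs)) = Suc n"
      using distinct_card[OF p(3)] p(2) by (simp add: star_paths_def)
    with bound[of "set ((a, 0) # xs)"] show ?thesis
      by (simp add: V_def p(1))
  qed
  have W_ev: "W n \<in> events" for n
    unfolding W_def using V_ev finPi by blast
  have two: "Suc n \<le> 2 ^ n" for n
    by (simp add: Suc_leI)
  have W_prob: "prob (W n) \<le> (1/36) * (1/2) ^ n" for n
  proof -
    have "prob (W n) \<le> (\<Sum>p\<in>Pi n. prob (V p))"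
      unfolding W_def by (rule measure_UNION_le) (use V_ev finPi in auto)
    also have "\<dots> \<le> (\<Sum>p\<in>Pi n. (1/36) ^ Suc n)"
      by (rule sum_mono) (rule V_prob)
    also have "\<dots> = real (card (Pi n)) * (1/36) ^ Suc n"
      by simp
    also have "\<dots> \<le> (2 ^ n * 9 ^ n) * (1/36) ^ Suc n"
    proof (rule mult_right_mono)
      have "card (Pi n) \<le> 2 ^ n * 9 ^ n"
        using cardPi[of n] two[of n] by (meson mult_le_mono1 order_trans)
      then have "real (card (Pi n)) \<le> real (2 ^ n * 9 ^ n)"
        by (rule of_nat_mono)
      then show "real (card (Pi n)) \<le> 2 ^ n * 9 ^ n"
        by simp
    qed simp
    also have "\<dots> = (1/36) * (2 * 9 * (1/36)) ^ n"
      by (simp only: power_mult_distrib power_Suc mult_ac)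
    finally show ?thesis by simp
  qed
  have geo: "(\<lambda>n. (1/36) * (1/2) ^ n :: real) sums (1/18)"
    using sums_mult[OF geometric_sums[of "1/2::real"], of "1/36"] by simp
  have summ: "summable (\<lambda>n. prob (W n))"
    by (rule summable_comparison_test'[OF sums_summable[OF geo]]) (use W_prob in auto)
  have "prob (\<Union>n. W n) \<le> (\<Sum>n. prob (W n))"
    by (rule finite_measure_subadditive_countably) (use W_ev summ in auto)
  also have "\<dots> \<le> 1/18"
    using suminf_le[OF W_prob summ sums_summable[OF geo]] geo by (simp add: sums_iff)
  finally have WU: "prob (\<Union>n. W n) \<le> 1/18" .
  have "space M \<subseteq> A \<union> (Bad (0, 0) \<union> (\<Union>n. W n))"
  proof
    fix \<omega> assume \<omega>: "\<omega> \<in> space M"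
    show "\<omega> \<in> A \<union> (Bad (0, 0) \<union> (\<Union>n. W n))"
    proof (rule ccontr)
      assume n: "\<omega> \<notin> A \<union> (Bad (0, 0) \<union> (\<Union>n. W n))"
      then have "finite ((Restr nbr {u. \<omega> \<notin> Bad u})\<^sup>* `` {(0, 0)})"
        using imp[OF \<omega>] by blast
      moreover have "(0, 0) \<in> {u. \<omega> \<notin> Bad u}"
        using n by simp
      ultimately obtain n a xs where *: "a \<le> n" "xs \<in> star_paths (a, 0) n"
        "distinct ((a, 0) # xs)" "set ((a, 0) # xs) \<subseteq> - {u. \<omega> \<notin> Bad u}"
        using finite_cluster_bad_path by metis
      then have "(a, xs) \<in> Pi n" "\<omega> \<in> V (a, xs)"
        by (auto simp: Pi_def V_def)
      then have "\<omega> \<in> W n" by (auto simp: W_def)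
      with n show False by blast
    qed
  qed
  then have "1 \<le> prob (A \<union> (Bad (0, 0) \<union> (\<Union>n. W n)))"
    using finite_measure_mono[of "space M" "A \<union> (Bad (0, 0) \<union> (\<Union>n. W n))"] A Bad W_ev
    by (simp add: prob_space sets.countable_UN)
  also have "\<dots> \<le> prob A + prob (Bad (0, 0) \<union> (\<Union>n. W n))"
    by (rule measure_Un_le) (use A Bad W_ev in auto)
  also have "prob (Bad (0, 0) \<union> (\<Union>n. W n)) \<le> prob (Bad (0, 0)) + prob (\<Union>n. W n)"
    by (rule measure_Un_le) (use A Bad W_ev in auto)
  also have "prob (Bad (0, 0)) \<le> 1/36"
    using bound[of "{(0, 0)}"] by simp
  finally show ?thesis
    using WU by simp
qed

subsection \<open>Measurability of the percolation event\<close>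

text \<open>Replaces the comparison \<open>dist x y > \<alpha> * nn_dist S k x\<close>, which involves an infimum, by a
  count of points.\<close>

definition many_closer :: "nat \<Rightarrow> real \<Rightarrow> 'a::metric_space set \<Rightarrow> 'a \<Rightarrow> 'a \<Rightarrow> bool" where
  "many_closer k \<alpha> S x y \<longleftrightarrow> k \<le> card {z \<in> S - {x}. \<alpha> * dist x z < dist x y}"

lemma configurations_finite:
  "S \<in> configurations \<Longrightarrow> bounded B \<Longrightarrow> finite (S \<inter> B)"
  by (simp add: configurations_def)

lemma finite_closer:
  assumes "S \<in> configurations" "\<alpha> > 0"
  shows "finite {z \<in> S - {x}. \<alpha> * dist x z < d}"
proof (rule finite_subset)
  show "{z \<in> S - {x}. \<alpha> * dist x z < d} \<subseteq> S \<inter> ball x (d / \<alpha>)"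
    using assms(2) by (auto simp: field_simps)
  show "finite (S \<inter> ball x (d / \<alpha>))"
    using assms(1) by (rule configurations_finite) simp
qed

text \<open>By local finiteness only finitely many points are closer to \<open>x\<close> than
  \<open>t = dist x y / \<alpha>\<close>. If there are at least \<open>k\<close> of them, the
  largest of their distances is still below \<open>t\<close> and bounds the infimum. Infinitude of
  \<open>S\<close> makes the set under the infimum nonempty.\<close>

lemma dist_le_nn_dist_iff:
  assumes S: "S \<in> configurations" "infinite S" and \<alpha>: "\<alpha> > 0" and k: "k \<ge> 1"
  shows "dist x y \<le> \<alpha> * nn_dist S k x \<longleftrightarrow> \<not> many_closer k \<alpha> S x y"
proof -
  define t where "t = dist x y / \<alpha>"
  define A where "A = {r. 0 \<le> r \<and> k \<le> card {y \<in> S - {x}. dist x y \<le> r}}"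
  have nn: "nn_dist S k x = Inf A"
    by (simp add: nn_dist_def A_def)
  have fin_le: "finite {y \<in> S - {x}. dist x y \<le> r}" for r
  proof (rule finite_subset)
    show "{y \<in> S - {x}. dist x y \<le> r} \<subseteq> S \<inter> cball x r" by auto
    show "finite (S \<inter> cball x r)"
      using S(1) by (rule configurations_finite) simp
  qed
  have bdd: "bdd_below A"
    by (rule bdd_belowI[of _ 0]) (auto simp: A_def)
  have ne: "A \<noteq> {}"
  proof -
    obtain T where T: "T \<subseteq> S - {x}" "finite T" "card T = k"
      using infinite_arbitrarily_large[of "S - {x}" k] S(2) by auto
    define r where "r = Max (dist x ` T)"
    have "T \<subseteq> {y \<in> S - {x}. dist x y \<le> r}"
      using T unfolding r_def by auto
    from card_mono[OF fin_le this] T(3) have "k \<le> card {y \<in> S - {x}. dist x y \<le> r}"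
      by simp
    moreover have "0 \<le> r"
    proof -
      obtain z where "z \<in> T" using T k by fastforce
      then have "dist x z \<le> r" unfolding r_def using T by auto
      then show ?thesis using zero_le_dist[of x z] by linarith
    qed
    ultimately show ?thesis by (auto simp: A_def)
  qed
  have "many_closer k \<alpha> S x y \<longleftrightarrow> k \<le> card {z \<in> S - {x}. dist x z < t}"
    using \<alpha> by (simp add: many_closer_def t_def field_simps)
  also have "\<dots> \<longleftrightarrow> Inf A < t"
  proof
    assume *: "k \<le> card {z \<in> S - {x}. dist x z < t}"
    define Z where "Z = {z \<in> S - {x}. dist x z < t}"
    define r where "r = Max (dist x ` Z)"
    have Z: "finite Z"
      unfolding Z_def by (rule finite_subset[OF _ fin_le[of t]]) auto
    have "Z \<noteq> {}"
      using * k unfolding Z_def[symmetric] by auto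
    with Z have r: "r \<in> dist x ` Z"
      unfolding r_def by (intro Max_in) auto
    then have "r < t" "0 \<le> r" by (auto simp: Z_def)
    have "Z \<subseteq> {y \<in> S - {x}. dist x y \<le> r}"
      using Z unfolding r_def by (auto simp: Z_def)
    from order_trans[OF *[folded Z_def] card_mono[OF fin_le this]]
    have "k \<le> card {y \<in> S - {x}. dist x y \<le> r}" .
    with \<open>0 \<le> r\<close> have "r \<in> A" by (simp add: A_def)
    then have "Inf A \<le> r" using bdd by (rule cInf_lower)
    with \<open>r < t\<close> show "Inf A < t" by simp
  next
    assume "Inf A < t"
    then obtain r where r: "r \<in> A" "r < t"
      using cInf_lessD[OF ne] by blast
    have "card {y \<in> S - {x}. dist x y \<le> r} \<le> card {z \<in> S - {x}. dist x z < t}"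
    proof (rule card_mono)
      show "finite {z \<in> S - {x}. dist x z < t}"
        by (rule finite_subset[OF _ fin_le[of t]]) auto
    qed (use r in auto)
    then show "k \<le> card {z \<in> S - {x}. dist x z < t}"
      using r by (simp add: A_def)
  qed
  finally show ?thesis
    using \<alpha> by (auto simp: nn t_def field_simps not_less)
qed

definition closer_edges :: "nat \<Rightarrow> real \<Rightarrow> 'a::metric_space set \<Rightarrow> ('a \<times> 'a) set" where
  "closer_edges k \<alpha> S = {(x, y). x \<in> S \<and> y \<in> S \<and> x \<noteq> y \<and>
     (\<not> many_closer k \<alpha> S x y \<or> \<not> many_closer k \<alpha> S y x)}"

lemma GN_edges_eq_closer_edges:
  assumes "S \<in> configurations" "infinite S" "\<alpha> > 0" "k \<ge> 1"
  shows "GN_edges k \<alpha> S = closer_edges k \<alpha> S"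
proof -
  have "dist x y \<le> \<alpha> * nn_dist S k y \<longleftrightarrow> \<not> many_closer k \<alpha> S y x" for x y
    using dist_le_nn_dist_iff[OF assms, of y x] by (simp add: dist_commute)
  then show ?thesis
    by (simp add: GN_edges_def closer_edges_def dist_le_nn_dist_iff[OF assms])
qed

text \<open>A subset of a locally finite set is infinite iff it is unbounded, which is tested by
  natural radii \<open>N\<close>; reachability is split by the number \<open>n\<close> of steps.
  Only the quantifiers over points then remain to be made countable. A finite \<open>S\<close> has
  no infinite component, whatever the unspecified values of \<open>nn_dist\<close>.\<close>

lemma infinite_component_iff:
  assumes S: "S \<in> configurations" and "\<alpha> > 0" "k \<ge> 1"
  shows "infinite_component S (GN_edges k \<alpha> S) \<longleftrightarrow>
    infinite S \<and> (\<exists>x\<in>S. \<forall>N::nat. \<exists>y\<in>S. \<exists>n. (x, y) \<in> closer_edges k \<alpha> S ^^ n \<and> real N < norm y)"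
proof (cases "infinite S")
  case True
  let ?E = "closer_edges k \<alpha> S"
  have sub: "?E\<^sup>* `` {x} \<subseteq> S" if "x \<in> S" for x
  proof
    fix y assume "y \<in> ?E\<^sup>* `` {x}"
    then have "(x, y) \<in> ?E\<^sup>*" by simp
    then show "y \<in> S" by cases (use that in \<open>auto simp: closer_edges_def\<close>)
  qed
  have "infinite (?E\<^sup>* `` {x}) \<longleftrightarrow> (\<forall>N::nat. \<exists>y\<in>S. \<exists>n. (x, y) \<in> ?E ^^ n \<and> real N < norm y)"
    if x: "x \<in> S" for x
  proof -
    have "infinite (?E\<^sup>* `` {x}) \<longleftrightarrow> \<not> bounded (?E\<^sup>* `` {x})"
      using configurations_finite[OF S, of "?E\<^sup>* `` {x}"] sub[OF x] finite_imp_bounded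
      by (auto simp: Int_absorb1)
    also have "\<dots> \<longleftrightarrow> (\<forall>N::nat. \<exists>y\<in>?E\<^sup>* `` {x}. real N < norm y)"
    proof -
      have "bounded X \<longleftrightarrow> (\<exists>N::nat. \<forall>y\<in>X. norm y \<le> real N)" for X :: "'a set"
        unfolding bounded_iff by (meson order_trans real_arch_simple)
      then show ?thesis by (auto simp: not_le)
    qed
    also have "\<dots> \<longleftrightarrow> (\<forall>N::nat. \<exists>y\<in>S. \<exists>n. (x, y) \<in> ?E ^^ n \<and> real N < norm y)"
    proof -
      have "y \<in> ?E\<^sup>* `` {x} \<longleftrightarrow> y \<in> S \<and> (\<exists>n. (x, y) \<in> ?E ^^ n)" for y
        using sub[OF x] rtrancl_power[of "(x, y)" ?E] by blast
      then show ?thesis by blast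
    qed
    finally show ?thesis .
  qed
  then show ?thesis
    using True GN_edges_eq_closer_edges[OF S True assms(2,3)]
    unfolding infinite_component_def by simp
next
  case False
  have "finite ((GN_edges k \<alpha> S)\<^sup>* `` {x})" if "x \<in> S" for x
  proof (rule finite_subset)
    show "(GN_edges k \<alpha> S)\<^sup>* `` {x} \<subseteq> S"
    proof
      fix y assume "y \<in> (GN_edges k \<alpha> S)\<^sup>* `` {x}"
      then have "(x, y) \<in> (GN_edges k \<alpha> S)\<^sup>*" by simp
      then show "y \<in> S" by cases (use that in \<open>auto simp: GN_edges_def\<close>)
    qed
  qed (use False in simp)
  then show ?thesis
    using False by (simp add: infinite_component_def)
qed

text \<open>The points of \<open>S\<close> alone in some \<open>Q i\<close> exhaust \<open>S\<close>, so that quantification over the points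
  becomes countable quantification over random variables.\<close>

lemma isolating_sequence:
  obtains Q :: "nat \<Rightarrow> 'a::euclidean_space set" where "range Q \<subseteq> bounded_borel"
    "\<And>S x. S \<in> configurations \<Longrightarrow> x \<in> S \<Longrightarrow> \<exists>i. S \<inter> Q i = {x}"
proof -
  obtain \<B> :: "'a set set" where B: "countable \<B>" "topological_basis \<B>"
    using ex_countable_basis by blast
  \<comment> \<open>Only bounded basis sets belong to \<open>bounded_borel\<close>; the empty set
    makes \<open>D\<close> nonempty, so that it can be enumerated.\<close>
  define D where "D = insert {} {b \<in> \<B>. bounded b}"
  have D: "countable D" "D \<noteq> {}"
    using B by (auto simp: D_def)
  have rng: "range (from_nat_into D) = D"
    using D by (rule range_from_nat_into[rotated])
  show thesis
  proof (rule that[of "from_nat_into D"])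
    show "range (from_nat_into D) \<subseteq> bounded_borel"
      unfolding rng using topological_basis_open[OF B(2)]
      by (auto simp: D_def bounded_borel_def)
    fix S and x :: 'a assume S: "S \<in> configurations" "x \<in> S"
    define F where "F = (S \<inter> ball x 1) - {x}"
    \<comment> \<open>Local finiteness makes \<open>F\<close> finite, hence closed. A basis set
      around \<open>x\<close> inside this open set meets \<open>S\<close> in \<open>x\<close>
      alone.\<close>
    have "open (ball x 1 - F)"
      using configurations_finite[OF S(1), of "ball x 1"]
      by (intro open_Diff finite_imp_closed) (auto simp: F_def)
    moreover have "x \<in> ball x 1 - F" by (simp add: F_def)
    ultimately obtain b where b: "b \<in> \<B>" "x \<in> b" "b \<subseteq> ball x 1 - F"
      using topological_basisE[OF B(2)] by metis
    have "bounded b"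
      by (rule bounded_subset[of "ball x 1"]) (use b in auto)
    then have "b \<in> D" using b by (simp add: D_def)
    moreover have "S \<inter> b = {x}" using b S by (auto simp: F_def)
    ultimately show "\<exists>i. S \<inter> from_nat_into D i = {x}"
      using rng by (metis rangeE)
  qed
qed

section \<open>Counts and isolated points as random variables\<close>

lemma space_configuration_space: "space configuration_space = configurations"
  unfolding configuration_space_def by (rule space_measure_of) auto

lemma points_in_measurable:
  assumes "B \<in> bounded_borel" "sets M = sets configuration_space"
  shows "Measurable.pred M (\<lambda>S. points_in B S = n)"
proof -
  have "{S \<in> configurations. points_in B S = n} \<in> sets configuration_space"
    unfolding configuration_space_def using assms(1) by (subst sets_measure_of) auto
  then show ?thesis
    using sets_eq_imp_space_eq[OF assms(2)] assms(2) by (simp add: pred_def space_configuration_space)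
qed

text \<open>The default value 0 makes this a total function, so that it can be a random variable on
  the whole configuration space.\<close>

definition sole_point :: "'a::zero set \<Rightarrow> 'a set \<Rightarrow> 'a" where
  "sole_point B S = (if points_in B S = 1 then the_elem (S \<inter> B) else 0)"

lemma sole_point:
  assumes "points_in B S = 1"
  shows "S \<inter> B = {sole_point B S}"
proof -
  obtain x where "S \<inter> B = {x}"
    using assms unfolding points_in_def by (rule card_1_singletonE)
  then show ?thesis
    by (simp add: sole_point_def points_in_def)
qed

lemma sole_point_in:
  assumes "points_in B S = 1"
  shows "sole_point B S \<in> S"
proof -
  have "sole_point B S \<in> S \<inter> B"
    unfolding sole_point[OF assms] by simp
  then show ?thesis by simp
qed

text \<open>On the event that \<open>B\<close> holds exactly one point, that point lies in
  \<open>A\<close> iff \<open>B \<inter> A\<close> also holds exactly one. Preimages are thus events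
  about counts.\<close>

lemma sole_point_measurable:
  assumes B: "B \<in> bounded_borel" and M: "sets M = sets configuration_space"
  shows "sole_point B \<in> borel_measurable M"
proof (rule measurableI)
  fix A :: "'a set" assume A: "A \<in> sets borel"
  have sp: "space M = configurations"
    using sets_eq_imp_space_eq[OF M] by (simp add: space_configuration_space)
  have [measurable]: "Measurable.pred M (\<lambda>S. points_in B S = 1)"
    using B M by (rule points_in_measurable)
  have "B \<inter> A \<in> bounded_borel"
    using B A by (auto simp: bounded_borel_def intro: bounded_subset)
  then have [measurable]: "Measurable.pred M (\<lambda>S. points_in (B \<inter> A) S = 1)"
    using M by (rule points_in_measurable)
  have "sole_point B S \<in> A \<longleftrightarrow> (if points_in B S = 1 then points_in (B \<inter> A) S = 1 else 0 \<in> A)" for S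
  proof (cases "points_in B S = 1")
    case True
    have eq: "S \<inter> (B \<inter> A) = {sole_point B S} \<inter> A"
      using sole_point[OF True] by blast
    have "points_in (B \<inter> A) S = 1 \<longleftrightarrow> sole_point B S \<in> A"
      unfolding points_in_def eq by (cases "sole_point B S \<in> A") simp_all
    then show ?thesis using True by simp
  qed (simp add: sole_point_def)
  then have "sole_point B -` A \<inter> space M =
      {S \<in> space M. if points_in B S = 1 then points_in (B \<inter> A) S = 1 else 0 \<in> A}"
    by auto
  also have "\<dots> \<in> sets M" by measurable
  finally show "sole_point B -` A \<inter> space M \<in> sets M" .
qed simp

text \<open>The points of a configuration \<open>S\<close> are the values \<open>pt i S\<close> with
  \<open>sng i S\<close>. In terms of these, the event is built by countable quantification from
  distances between random points: first \<open>many_closer\<close>, then paths by induction on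
  their length, then unbounded components.\<close>

lemma infinite_component_measurable:
  fixes M :: "'a::euclidean_space set measure"
  assumes M: "sets M = sets configuration_space" and "\<alpha> > 0" "k \<ge> 1"
  shows "{S \<in> space M. infinite_component S (GN_edges k \<alpha> S)} \<in> sets M"
proof -
  have sp: "space M = configurations"
    using sets_eq_imp_space_eq[OF M] by (simp add: space_configuration_space)
  obtain Q :: "nat \<Rightarrow> 'a set" where Q: "range Q \<subseteq> bounded_borel"
    "\<And>S x. S \<in> configurations \<Longrightarrow> x \<in> S \<Longrightarrow> \<exists>i. S \<inter> Q i = {x}"
    by (rule isolating_sequence) blast
  define sng where "sng i = (\<lambda>S. points_in (Q i) S = 1)" for i
  define pt where "pt i = sole_point (Q i)" for i
  have sng_meas [measurable]: "Measurable.pred M (sng i)" for i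
    unfolding sng_def using Q(1) M by (intro points_in_measurable) auto
  have pt_meas [measurable]: "pt i \<in> borel_measurable M" for i
    unfolding pt_def using Q(1) M by (intro sole_point_measurable) auto
  have pt_in: "pt i S \<in> S" if "sng i S" for i S
    using sole_point_in that unfolding sng_def pt_def .
  have pt_ex: "\<exists>i. sng i S \<and> x = pt i S" if S: "S \<in> configurations" "x \<in> S" for S x
  proof -
    obtain i where i: "S \<inter> Q i = {x}" using Q(2)[OF S] by blast
    then have "sng i S" by (simp add: sng_def points_in_def)
    with sole_point[of "Q i" S] i show ?thesis by (auto simp: sng_def pt_def)
  qed
  have Bex_pt: "(\<exists>x\<in>S. R x) \<longleftrightarrow> (\<exists>i. sng i S \<and> R (pt i S))" if "S \<in> configurations" for S R
    using pt_in pt_ex[OF that] by blast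
  \<comment> \<open>The \<open>k\<close> distinct closer points are coded by a list of indices,
    because lists of naturals form a countable type.\<close>
  have many: "many_closer k \<alpha> S x y \<longleftrightarrow> (\<exists>w::nat list. \<forall>i<k. sng (w ! i) S \<and> pt (w ! i) S \<noteq> x \<and>
      \<alpha> * dist x (pt (w ! i) S) < dist x y \<and> (\<forall>j<k. i \<noteq> j \<longrightarrow> pt (w ! i) S \<noteq> pt (w ! j) S))"
    (is "_ \<longleftrightarrow> (\<exists>w. ?P w)") if S: "S \<in> configurations" for S x y
  proof
    let ?Z = "{z \<in> S - {x}. \<alpha> * dist x z < dist x y}"
    assume "many_closer k \<alpha> S x y"
    then obtain T where T: "T \<subseteq> ?Z" "card T = k" "finite T"
      unfolding many_closer_def by (meson obtain_subset_with_card_n)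
    then obtain zs where zs: "set zs = T" "distinct zs" "length zs = k"
      using finite_distinct_list[OF T(3)] distinct_card by metis
    have "\<exists>i. sng i S \<and> z = pt i S" if "z \<in> S" for z
      using pt_ex[OF S that] .
    then obtain g where g: "\<And>z. z \<in> S \<Longrightarrow> sng (g z) S \<and> z = pt (g z) S" by metis
    have z: "zs ! i \<in> ?Z" if "i < k" for i
      using zs T(1) that nth_mem by blast
    have "?P (map g zs)"
    proof (intro allI impI conjI)
      fix i assume i: "i < k"
      have gi: "sng (g (zs ! i)) S" "pt (g (zs ! i)) S = zs ! i" if "i < k" for i
        using g[of "zs ! i"] z[OF that] by auto
      show "sng (map g zs ! i) S" "pt (map g zs ! i) S \<noteq> x"
        "\<alpha> * dist x (pt (map g zs ! i) S) < dist x y"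
        using gi[OF i] z[OF i] i zs(3) by auto
      fix j assume j: "j < k" "i \<noteq> j"
      then show "pt (map g zs ! i) S \<noteq> pt (map g zs ! j) S"
        using gi[OF i] gi[OF j(1)] i zs by (simp add: nth_eq_iff_index_eq)
    qed
    then show "\<exists>w. ?P w" by blast
  next
    let ?Z = "{z \<in> S - {x}. \<alpha> * dist x z < dist x y}"
    assume "\<exists>w. ?P w"
    then obtain w where w: "?P w" by blast
    have inj: "inj_on (\<lambda>i. pt (w ! i) S) {..<k}"
      using w unfolding inj_on_def by (metis lessThan_iff)
    have "(\<lambda>i. pt (w ! i) S) ` {..<k} \<subseteq> ?Z"
      using w pt_in by auto
    from card_mono[OF finite_closer[OF S \<open>\<alpha> > 0\<close>] this] show "many_closer k \<alpha> S x y"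
      using card_image[OF inj] by (simp add: many_closer_def)
  qed
  have many_meas: "Measurable.pred M (\<lambda>S. many_closer k \<alpha> S (pt i S) (pt j S))" for i j
  proof -
    have "Measurable.pred M (\<lambda>S. \<exists>w::nat list. \<forall>l<k. sng (w ! l) S \<and> pt (w ! l) S \<noteq> pt i S \<and>
      \<alpha> * dist (pt i S) (pt (w ! l) S) < dist (pt i S) (pt j S) \<and>
      (\<forall>m<k. l \<noteq> m \<longrightarrow> pt (w ! l) S \<noteq> pt (w ! m) S))"
      by measurable
    then show ?thesis
      by (rule measurable_cong[THEN iffD1, rotated]) (simp add: sp many)
  qed
  note many_meas [measurable]
  \<comment> \<open>The conditions \<open>sng i S\<close> and \<open>sng j S\<close> are part of the
    predicate because otherwise \<open>pt i S\<close> is the default 0, which need not be a point of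
    \<open>S\<close>. The induction splits off the last edge.\<close>
  have path_meas: "Measurable.pred M (\<lambda>S. sng i S \<and> sng j S \<and> (pt i S, pt j S) \<in> closer_edges k \<alpha> S ^^ n)"
    for i j n
  proof (induction n arbitrary: j)
    case 0
    show ?case by simp measurable
  next
    case (Suc n)
    note Suc [measurable]
    have "Measurable.pred M (\<lambda>S. \<exists>l. (sng i S \<and> sng l S \<and> (pt i S, pt l S) \<in> closer_edges k \<alpha> S ^^ n) \<and>
      sng j S \<and> pt l S \<noteq> pt j S \<and>
      (\<not> many_closer k \<alpha> S (pt l S) (pt j S) \<or> \<not> many_closer k \<alpha> S (pt j S) (pt l S)))"
      by measurable
    then show ?case
    proof (rule measurable_cong[THEN iffD1, rotated])
      fix S assume "S \<in> space M"
      then have S: "S \<in> configurations" by (simp add: sp)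
      have "(pt i S, pt j S) \<in> closer_edges k \<alpha> S ^^ Suc n \<longleftrightarrow>
        (\<exists>y\<in>S. (pt i S, y) \<in> closer_edges k \<alpha> S ^^ n \<and> (y, pt j S) \<in> closer_edges k \<alpha> S)"
        by (auto simp: closer_edges_def)
      also have "\<dots> \<longleftrightarrow> (\<exists>l. sng l S \<and> (pt i S, pt l S) \<in> closer_edges k \<alpha> S ^^ n \<and> (pt l S, pt j S) \<in> closer_edges k \<alpha> S)"
        using Bex_pt[OF S] by simp
      finally show "(\<exists>l. (sng i S \<and> sng l S \<and> (pt i S, pt l S) \<in> closer_edges k \<alpha> S ^^ n) \<and>
        sng j S \<and> pt l S \<noteq> pt j S \<and>
        (\<not> many_closer k \<alpha> S (pt l S) (pt j S) \<or> \<not> many_closer k \<alpha> S (pt j S) (pt l S))) =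
        (sng i S \<and> sng j S \<and> (pt i S, pt j S) \<in> closer_edges k \<alpha> S ^^ Suc n)"
        using pt_in[of _ S] by (auto simp: closer_edges_def)
    qed
  qed
  note path_meas [measurable]
  have inf_iff: "infinite S \<longleftrightarrow> (\<forall>N::nat. \<exists>y\<in>S. real N < norm y)" if "S \<in> configurations" for S
  proof -
    have "infinite S \<longleftrightarrow> \<not> bounded S"
      using configurations_finite[OF that, of S] finite_imp_bounded by auto
    also have "\<dots> \<longleftrightarrow> (\<forall>N::nat. \<exists>y\<in>S. real N < norm y)"
      unfolding bounded_iff by (meson linorder_not_le order_trans real_arch_simple)
    finally show ?thesis .
  qed
  have "Measurable.pred M (\<lambda>S. (\<forall>N::nat. \<exists>j. sng j S \<and> real N < norm (pt j S)) \<and>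
    (\<exists>i. \<forall>N::nat. \<exists>j n. (sng i S \<and> sng j S \<and> (pt i S, pt j S) \<in> closer_edges k \<alpha> S ^^ n) \<and> real N < norm (pt j S)))"
    by measurable
  then have "Measurable.pred M (\<lambda>S. infinite_component S (GN_edges k \<alpha> S))"
  proof (rule measurable_cong[THEN iffD1, rotated])
    fix S assume "S \<in> space M"
    then have S: "S \<in> configurations" by (simp add: sp)
    show "((\<forall>N::nat. \<exists>j. sng j S \<and> real N < norm (pt j S)) \<and>
      (\<exists>i. \<forall>N::nat. \<exists>j n. (sng i S \<and> sng j S \<and> (pt i S, pt j S) \<in> closer_edges k \<alpha> S ^^ n) \<and> real N < norm (pt j S)))
      = infinite_component S (GN_edges k \<alpha> S)"
      unfolding infinite_component_iff[OF S assms(2,3)] inf_iff[OF S] Bex_pt[OF S]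
      by (intro conj_cong ex_cong1 refl) blast
  qed
  then show ?thesis by (simp add: pred_def)
qed

subsection \<open>Good sites for the Poisson process\<close>

text \<open>The independence in \<open>poisson_process_law\<close> is indexed by the sets
  themselves. Disjoint nonempty sets are distinct, so \<open>B\<close> is injective on
  \<open>T\<close> and the product can be reindexed along it.\<close>

lemma poisson_prob_Inter:
  assumes law: "poisson_process_law \<rho> P" and T: "finite T" "T \<noteq> {}"
    and B: "\<And>u. u \<in> T \<Longrightarrow> B u \<in> bounded_borel" "\<And>u. u \<in> T \<Longrightarrow> B u \<noteq> {}"
      "disjoint_family_on B T"
  shows "measure P (\<Inter>u\<in>T. {S \<in> space P. points_in (B u) S \<in> A u}) =
    (\<Prod>u\<in>T. measure P {S \<in> space P. points_in (B u) S \<in> A u})"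
proof -
  interpret prob_space P
    using law by (simp add: poisson_process_law_def)
  have inj: "inj_on B T"
  proof (rule inj_onI, rule ccontr)
    fix u v assume uv: "u \<in> T" "v \<in> T" "B u = B v" "u \<noteq> v"
    then have "B u \<inter> B v = {}" using B(3) by (auto simp: disjoint_family_on_def)
    with uv B(2) show False by simp
  qed
  define A' where "A' b = points_in b -` A (inv_into T B b) \<inter> space P" for b
  have A': "A' (B u) = {S \<in> space P. points_in (B u) S \<in> A u}" if "u \<in> T" for u
    using inv_into_f_f[OF inj that] by (auto simp: A'_def)
  have "disjoint (B ` T)"
    using B(3) by (rule disjoint_family_on_disjoint_image)
  moreover have "\<forall>\<B>. finite \<B> \<and> \<B> \<subseteq> bounded_borel \<and> disjoint \<B> \<longrightarrow>
      indep_vars (\<lambda>_. count_space UNIV) points_in \<B>"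
    using law by (simp add: poisson_process_law_def)
  ultimately have "indep_vars (\<lambda>_. count_space UNIV) points_in (B ` T)"
    using T(1) B(1) by (simp add: image_subset_iff)
  then have "indep_sets (\<lambda>b. {points_in b -` A \<inter> space P | A. A \<in> sets (count_space UNIV)}) (B ` T)"
    unfolding indep_vars_def2 by blast
  then have "prob (\<Inter>b\<in>B ` T. A' b) = (\<Prod>b\<in>B ` T. prob (A' b))"
    by (rule indep_setsD) (use T in \<open>auto simp: A'_def\<close>)
  then show ?thesis
    by (simp add: prod.reindex[OF inj] A' cong: INF_cong prod.cong)
qed

lemma poisson_pred:
  assumes law: "poisson_process_law \<rho> P" and B: "B \<in> bounded_borel"
  shows "{S \<in> space P. points_in B S \<in> A} \<in> sets P"
proof -
  have "Measurable.pred P (\<lambda>S. points_in B S = n)" for n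
    using law B by (intro points_in_measurable) (auto simp: poisson_process_law_def)
  note this [measurable]
  have "{S \<in> space P. points_in B S \<in> A} = {S \<in> space P. \<exists>n. n \<in> A \<and> points_in B S = n}"
    by auto
  also have "\<dots> \<in> sets P" by measurable
  finally show ?thesis .
qed

lemma poisson_empty_or_crowded:
  assumes law: "poisson_process_law \<rho> P" and T: "finite T" "T \<noteq> {}"
    and B: "\<And>u. u \<in> T \<Longrightarrow> C u \<in> bounded_borel" "\<And>u. u \<in> T \<Longrightarrow> D u \<in> bounded_borel"
      "\<And>u. u \<in> T \<Longrightarrow> C u \<noteq> {}" "\<And>u. u \<in> T \<Longrightarrow> C u \<subseteq> D u" "disjoint_family_on D T"
    and C: "\<And>u. u \<in> T \<Longrightarrow> measure P {S \<in> space P. points_in (C u) S = 0} \<le> \<delta>"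
    and D: "\<And>u. u \<in> T \<Longrightarrow> measure P {S \<in> space P. k \<le> points_in (D u) S} \<le> \<delta>"
  shows "measure P (\<Inter>u\<in>T. {S \<in> space P. points_in (C u) S = 0 \<or> k \<le> points_in (D u) S})
    \<le> (2 * \<delta>) ^ card T"
proof -
  interpret prob_space P
    using law by (simp add: poisson_process_law_def)
  text \<open>Choosing for each \<open>u\<close> which of the two failures occurs leaves one count per \<open>u\<close>, over pairwise
    disjoint sets. This avoids the joint law of the counts in \<open>C u\<close> and \<open>D u\<close>.\<close>
  define B' where "B' U u = (if u \<in> U then C u else D u)" for U u
  define A where "A U u = (if u \<in> U then {0} else {k..})" for U and u :: 'b
  define V where "V U = (\<Inter>u\<in>T. {S \<in> space P. points_in (B' U u) S \<in> A U u})" for U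
  have B'_borel: "B' U u \<in> bounded_borel" if "u \<in> T" for U u
    using B that by (simp add: B'_def)
  have V_ev: "V U \<in> events" for U
    unfolding V_def by (intro sets.finite_INT T) (use B'_borel poisson_pred[OF law] in auto)
  have V_prob: "prob (V U) \<le> \<delta> ^ card T" for U
  proof -
    have "prob (V U) = (\<Prod>u\<in>T. prob {S \<in> space P. points_in (B' U u) S \<in> A U u})"
      unfolding V_def
    proof (rule poisson_prob_Inter[OF law T])
      show "B' U u \<in> bounded_borel" if "u \<in> T" for u by (rule B'_borel[OF that])
      show "B' U u \<noteq> {}" if "u \<in> T" for u
        using B(3,4)[OF that] by (auto simp: B'_def)
      have sub: "B' U u \<subseteq> D u" if "u \<in> T" for u
        using B(4)[OF that] by (auto simp: B'_def)
      show "disjoint_family_on (B' U) T"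
        unfolding disjoint_family_on_def
      proof (intro ballI impI)
        fix u v assume "u \<in> T" "v \<in> T" "u \<noteq> v"
        moreover from this have "D u \<inter> D v = {}"
          using B(5) by (simp add: disjoint_family_on_def)
        ultimately show "B' U u \<inter> B' U v = {}"
          using sub[of u] sub[of v] by blast
      qed
    qed
    also have "\<dots> \<le> (\<Prod>u\<in>T. \<delta>)"
      by (rule prod_mono) (use C D in \<open>auto simp: B'_def A_def\<close>)
    finally show ?thesis by simp
  qed
  have "(\<Inter>u\<in>T. {S \<in> space P. points_in (C u) S = 0 \<or> k \<le> points_in (D u) S}) \<subseteq> (\<Union>U\<in>Pow T. V U)"
  proof
    fix S assume S: "S \<in> (\<Inter>u\<in>T. {S \<in> space P. points_in (C u) S = 0 \<or> k \<le> points_in (D u) S})"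
    define U where "U = {u \<in> T. points_in (C u) S = 0}"
    have "S \<in> V U"
      using S by (auto simp: V_def B'_def A_def U_def)
    then show "S \<in> (\<Union>U\<in>Pow T. V U)" by (auto simp: U_def)
  qed
  then have "prob (\<Inter>u\<in>T. {S \<in> space P. points_in (C u) S = 0 \<or> k \<le> points_in (D u) S})
      \<le> prob (\<Union>U\<in>Pow T. V U)"
    by (rule finite_measure_mono) (use V_ev T in auto)
  also have "\<dots> \<le> (\<Sum>U\<in>Pow T. prob (V U))"
    by (rule measure_UNION_le) (use V_ev T in auto)
  also have "\<dots> \<le> (\<Sum>U\<in>Pow T. \<delta> ^ card T)"
    by (rule sum_mono) (rule V_prob)
  also have "\<dots> = (2 * \<delta>) ^ card T"
    using T by (simp add: card_Pow power_mult_distrib)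
  finally show ?thesis .
qed

section \<open>Void and tail probabilities of Poisson counts\<close>

lemma poisson_void:
  assumes law: "poisson_process_law \<rho> P" and B: "B \<in> bounded_borel"
  shows "measure P {S \<in> space P. points_in B S = 0} = exp (- (\<rho> * measure lborel B))"
proof -
  have "measure P {S \<in> space P. points_in B S = n} =
      (\<rho> * measure lborel B) ^ n / fact n * exp (- (\<rho> * measure lborel B))" for n
    using law B unfolding poisson_process_law_def by (elim conjE) (drule (1) bspec, erule spec)
  from this[of 0] show ?thesis by simp
qed

lemma poisson_tail:
  assumes law: "poisson_process_law \<rho> P" and B: "B \<in> bounded_borel"
  shows "measure P {S \<in> space P. k \<le> points_in B S} =
    1 - (\<Sum>n<k. (\<rho> * measure lborel B) ^ n / fact n * exp (- (\<rho> * measure lborel B)))"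
proof -
  interpret prob_space P
    using law by (simp add: poisson_process_law_def)
  have ev: "{S \<in> space P. points_in B S \<in> A} \<in> events" for A
    using law B by (rule poisson_pred)
  have "prob (\<Union>n\<in>{..<k}. {S \<in> space P. points_in B S = n}) = (\<Sum>n<k. prob {S \<in> space P. points_in B S = n})"
    by (rule finite_measure_finite_Union) (use ev[of "{_}"] in \<open>auto simp: disjoint_family_on_def\<close>)
  also have "\<dots> = (\<Sum>n<k. (\<rho> * measure lborel B) ^ n / fact n * exp (- (\<rho> * measure lborel B)))"
    using law B by (simp add: poisson_process_law_def)
  finally have eq: "prob (\<Union>n\<in>{..<k}. {S \<in> space P. points_in B S = n}) = \<dots>" .
  have "{S \<in> space P. k \<le> points_in B S} = space P - (\<Union>n\<in>{..<k}. {S \<in> space P. points_in B S = n})"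
    by auto
  moreover have "(\<Union>n\<in>{..<k}. {S \<in> space P. points_in B S = n}) \<in> events"
    using ev[of "{_}"] by auto
  ultimately show ?thesis
    using prob_compl eq by simp
qed

text \<open>The Poisson weights are the terms of the exponential series times
  \<open>exp (- \<mu>)\<close>, so their partial sums tend to 1.\<close>

lemma poisson_tail_small:
  fixes \<mu> \<delta> :: real
  assumes "\<delta> > 0"
  obtains k where "k \<ge> 1" "1 - (\<Sum>n<k. \<mu> ^ n / fact n * exp (- \<mu>)) \<le> \<delta>"
proof -
  have "(\<lambda>n. \<mu> ^ n / fact n * exp (- \<mu>)) sums (exp \<mu> * exp (- \<mu>))"
    using sums_mult2[OF exp_converges[of \<mu>], of "exp (- \<mu>)"] by (simp add: divide_inverse mult_ac)
  then have "(\<lambda>k. \<Sum>n<k. \<mu> ^ n / fact n * exp (- \<mu>)) \<longlonglongrightarrow> 1"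
    by (simp add: sums_def exp_minus)
  then have "eventually (\<lambda>k. (\<Sum>n<k. \<mu> ^ n / fact n * exp (- \<mu>)) > 1 - \<delta>) sequentially"
    by (rule order_tendstoD) (use assms in simp)
  then obtain N where "\<forall>k\<ge>N. (\<Sum>n<k. \<mu> ^ n / fact n * exp (- \<mu>)) > 1 - \<delta>"
    by (auto simp: eventually_sequentially)
  then have "(\<Sum>n<max N 1. \<mu> ^ n / fact n * exp (- \<mu>)) > 1 - \<delta>"
    by simp
  then show thesis
    by (intro that[of "max N 1"]) auto
qed

text \<open>The residues of both coordinates modulo \<open>m\<close> sort the sites into
  \<open>m\<^sup>2\<close> classes. By the pigeonhole principle some class holds at least the
  average share, and distinct sites of one class differ in some coordinate by a nonzero multiple of
  \<open>m\<close>.\<close>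

lemma sparse_subset:
  fixes T :: "(nat \<times> nat) set"
  assumes T: "finite T" and m: "m \<ge> 1"
  obtains T' where "T' \<subseteq> T" "card T \<le> m\<^sup>2 * card T'"
    "\<And>u v. u \<in> T' \<Longrightarrow> v \<in> T' \<Longrightarrow> u \<noteq> v \<Longrightarrow>
      real m \<le> \<bar>real (fst u) - real (fst v)\<bar> \<or> real m \<le> \<bar>real (snd u) - real (snd v)\<bar>"
proof -
  define f where "f = (\<lambda>u::nat \<times> nat. (fst u mod m, snd u mod m))"
  have "f \<in> T \<rightarrow> {..<m} \<times> {..<m}"
    using m by (auto simp: f_def)
  then obtain y where y: "card (f -` {y} \<inter> T) * card ({..<m} \<times> {..<m}) \<ge> card T"
    using pigeonhole_card[of f T "{..<m} \<times> {..<m}"] T m by (auto simp: lessThan_empty_iff)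
  have far: "real m \<le> \<bar>real a - real b\<bar>" if "a mod m = b mod m" "a \<noteq> b" for a b
  proof -
    have "int m dvd int a - int b"
      using that(1) by (metis mod_eq_dvd_iff of_nat_mod)
    then have "int m \<le> \<bar>int a - int b\<bar>"
      using that(2) dvd_imp_le_int[of "int a - int b" "int m"] by simp
    then show ?thesis by linarith
  qed
  show thesis
  proof (rule that[of "f -` {y} \<inter> T"])
    show "card T \<le> m\<^sup>2 * card (f -` {y} \<inter> T)"
      using y by (simp add: power2_eq_square mult.commute)
    fix u v assume "u \<in> f -` {y} \<inter> T" "v \<in> f -` {y} \<inter> T" "u \<noteq> v"
    then have "fst u mod m = fst v mod m" "snd u mod m = snd v mod m"
      "fst u \<noteq> fst v \<or> snd u \<noteq> snd v"
      by (auto simp: f_def prod_eq_iff)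
    then show "real m \<le> \<bar>real (fst u) - real (fst v)\<bar> \<or> real m \<le> \<bar>real (snd u) - real (snd v)\<bar>"
      using far by blast
  qed simp
qed

section \<open>From good sites to percolation\<close>

lemma ball_bounded_borel: "ball x r \<in> bounded_borel"
  by (simp add: bounded_borel_def)

text \<open>The deterministic part. One point of \<open>S\<close> is chosen in the small ball of
  each good site. By \<open>far\<close> the small balls are disjoint, so the choice is injective;
  neighbouring good sites give adjacent points, so an infinite cluster of sites yields an infinite
  component.\<close>

lemma good_cluster_infinite_component:
  fixes pos :: "nat \<times> nat \<Rightarrow> 'a::euclidean_space"
  assumes S: "S \<in> configurations" and \<alpha>: "\<alpha> > 0" and k: "k \<ge> 1" and s: "s > 0"
    and far: "\<And>u v. u \<noteq> v \<Longrightarrow> s \<le> dist (pos u) (pos v)"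
    and near: "\<And>u v. (u, v) \<in> nbr \<Longrightarrow> dist (pos u) (pos v) \<le> s"
    and G: "\<And>u. u \<in> G \<Longrightarrow> points_in (ball (pos u) (s / 2)) S \<noteq> 0 \<and>
      points_in (ball (pos u) ((1/2 + 2/\<alpha>) * s)) S < k"
    and origin: "u0 \<in> G" and inf: "infinite ((Restr nbr G)\<^sup>* `` {u0})"
  shows "infinite_component S (GN_edges k \<alpha> S)"
proof -
  have "\<exists>x. x \<in> S \<inter> ball (pos u) (s / 2)" if "u \<in> G" for u
    using G[OF that] unfolding points_in_def by (metis card.empty ex_in_conv)
  then obtain p where p: "\<And>u. u \<in> G \<Longrightarrow> p u \<in> S \<inter> ball (pos u) (s / 2)"
    by metis
  have p_S: "p u \<in> S" and p_near: "dist (pos u) (p u) < s / 2" if "u \<in> G" for u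
    using p[OF that] by auto
  have inj: "p u \<noteq> p v" if "u \<in> G" "v \<in> G" "u \<noteq> v" for u v
    using far[OF that(3)] p_near[OF that(1)] p_near[OF that(2)]
      dist_triangle2[of "pos u" "pos v" "p u"] by auto
  have edge: "(p u, p v) \<in> closer_edges k \<alpha> S" if uv: "(u, v) \<in> Restr nbr G" for u v
  proof -
    have u: "u \<in> G" and v: "v \<in> G" and nb: "(u, v) \<in> nbr"
      using uv by auto
    have "u \<noteq> v" using nb by (auto simp: nbr_def)
    have d: "dist (p u) (p v) < 2 * s"
      using p_near[OF u] p_near[OF v] near[OF nb]
        dist_triangle[of "p u" "p v" "pos u"] dist_triangle[of "pos u" "p v" "pos v"]
        dist_commute[of "p u" "pos u"] by linarith
    \<comment> \<open>A point closer to \<open>p u\<close> than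
      \<open>dist (p u) (p v) / \<alpha>\<close> lies within \<open>s / 2 + 2 * s / \<alpha>\<close>
      of \<open>pos u\<close>; this is where the large radius comes from.\<close>
    have "{z \<in> S - {p u}. \<alpha> * dist (p u) z < dist (p u) (p v)} \<subseteq>
        S \<inter> ball (pos u) ((1/2 + 2/\<alpha>) * s)"
    proof
      fix z assume z: "z \<in> {z \<in> S - {p u}. \<alpha> * dist (p u) z < dist (p u) (p v)}"
      then have "\<alpha> * dist (p u) z < 2 * s" using d by simp
      then have "dist (p u) z < 2 * s / \<alpha>" using \<alpha> by (simp add: field_simps)
      then have "dist (pos u) z < s / 2 + 2 * s / \<alpha>"
        using p_near[OF u] dist_triangle[of "pos u" z "p u"] by linarith
      also have "\<dots> = (1/2 + 2/\<alpha>) * s" by (simp add: algebra_simps)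
      finally show "z \<in> S \<inter> ball (pos u) ((1/2 + 2/\<alpha>) * s)" using z by simp
    qed
    from card_mono[OF _ this] configurations_finite[OF S, of "ball (pos u) ((1/2 + 2/\<alpha>) * s)"] G[OF u]
    have "\<not> many_closer k \<alpha> S (p u) (p v)"
      by (simp add: many_closer_def points_in_def)
    then show ?thesis
      using p_S[OF u] p_S[OF v] inj[OF u v \<open>u \<noteq> v\<close>] by (simp add: closer_edges_def)
  qed
  let ?C = "(Restr nbr G)\<^sup>* `` {u0}"
  have C_G: "?C \<subseteq> G"
  proof
    fix u assume "u \<in> ?C"
    then have "(u0, u) \<in> (Restr nbr G)\<^sup>*" by simp
    then show "u \<in> G" by cases (use origin in auto)
  qed
  then have "inj_on p ?C"
    unfolding inj_on_def using inj by blast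
  then have infp: "infinite (p ` ?C)"
    using inf finite_imageD by blast
  have "p ` ?C \<subseteq> S" using C_G p_S by blast
  \<comment> \<open>\<open>GN_edges\<close> and \<open>closer_edges\<close> are known to agree on
    infinite configurations.\<close>
  then have "infinite S" using infp finite_subset by blast
  have "p ` ?C \<subseteq> (closer_edges k \<alpha> S)\<^sup>* `` {p u0}"
  proof -
    have "(p u0, p u) \<in> (closer_edges k \<alpha> S)\<^sup>*" if "(u0, u) \<in> (Restr nbr G)\<^sup>*" for u
      using that
    proof (induction rule: rtrancl_induct)
      case (step u v)
      then show ?case
        using edge[OF step(2)] by (meson rtrancl_into_rtrancl)
    qed simp
    then show ?thesis by blast
  qed
  then have "infinite ((closer_edges k \<alpha> S)\<^sup>* `` {p u0})"
    using infp finite_subset by blast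
  then show ?thesis
    unfolding infinite_component_def GN_edges_eq_closer_edges[OF S \<open>infinite S\<close> \<alpha> k]
    using p_S[OF origin] by blast
qed

text \<open>The constants \<open>m\<close>, \<open>\<delta>\<close>, \<open>\<mu>\<close> and
  \<open>k\<close> depend on \<open>\<alpha>\<close> and the dimension only; the density enters
  through the mesh \<open>s\<close>. Hence one \<open>k\<close> serves every density.\<close>

lemma GN_percolates_euclidean_space:
  assumes \<alpha>: "\<alpha> > 0" and dim: "DIM('a::euclidean_space) \<ge> 2"
  shows "\<exists>k\<ge>1. GN_percolates TYPE('a) k \<alpha>"
proof -
  \<comment> \<open>The two axes of the lattice plane; this is where the dimension bound
    enters.\<close>
  obtain e1 e2 :: 'a where e: "e1 \<in> Basis" "e2 \<in> Basis" "e1 \<noteq> e2"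
  proof -
    obtain X :: "'a set" where "X \<subseteq> Basis" "card X = 2"
      using obtain_subset_with_card_n[OF dim] by blast
    then show thesis using that by (auto simp: card_2_iff)
  qed
  define R where "R = 1/2 + 2/\<alpha>"
  have R: "R > 1/2" using \<alpha> by (simp add: R_def)
  \<comment> \<open>Two sites differing by at least \<open>m\<close> in some coordinate have
    disjoint large balls.\<close>
  define m where "m = nat \<lceil>2 * R\<rceil>"
  have m: "2 * R \<le> real m" "m \<ge> 1"
    using R by (auto simp: m_def) linarith+
  \<comment> \<open>A site is bad with probability at most \<open>2 * \<delta>\<close>, and thinning
    a set of sites keeps at least a fraction \<open>1 / m\<^sup>2\<close> of it. The exponent
    \<open>m\<^sup>2\<close> makes up for this loss.\<close>
  define \<delta> :: real where "\<delta> = (1/36) ^ m\<^sup>2 / 2"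
  have \<delta>: "0 < \<delta>" "\<delta> < 1"
  proof -
    show "0 < \<delta>" by (simp add: \<delta>_def)
    have "(1/36 :: real) ^ m\<^sup>2 \<le> 1" by (rule power_le_one) auto
    then show "\<delta> < 1" by (simp add: \<delta>_def)
  qed
  \<comment> \<open>The mean number of points in the large ball when the small one has mean
    \<open>- ln \<delta>\<close>: the radii \<open>R * s\<close> and \<open>s / 2\<close> have ratio
    \<open>2 * R\<close>.\<close>
  define \<mu> where "\<mu> = - ln \<delta> * (2 * R) ^ DIM('a)"
  obtain k where k: "k \<ge> 1" "1 - (\<Sum>n<k. \<mu> ^ n / fact n * exp (- \<mu>)) \<le> \<delta>"
    using poisson_tail_small[OF \<delta>(1)] .
  have "0 < measure P {S \<in> space P. infinite_component S (GN_edges k \<alpha> S)}"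
    if \<rho>: "\<rho> > 0" and law: "poisson_process_law \<rho> P" for \<rho> and P :: "'a set measure"
  proof -
    interpret prob_space P
      using law by (simp add: poisson_process_law_def)
    have sets_P: "sets P = sets configuration_space"
      using law by (simp add: poisson_process_law_def)
    have space_P: "space P = configurations"
      using sets_eq_imp_space_eq[OF sets_P] by (simp add: space_configuration_space)
    define V where "V = unit_ball_vol (real DIM('a))"
    have V: "V > 0" by (simp add: V_def)
    \<comment> \<open>Solves \<open>\<rho> * (V * (s / 2) ^ DIM('a)) = - ln \<delta>\<close>, so
      that a small ball is empty with probability exactly \<open>\<delta>\<close>.\<close>
    define s where "s = 2 * root DIM('a) (- ln \<delta> / (\<rho> * V))"
    have pos: "- ln \<delta> / (\<rho> * V) > 0"
      using \<delta> \<rho> V by (intro divide_pos_pos) auto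
    have s: "s > 0"
      using pos by (simp add: s_def)
    have half: "\<rho> * (V * (s / 2) ^ DIM('a)) = - ln \<delta>"
      using pos \<rho> V by (simp add: s_def)
    have vol: "\<rho> * measure lborel (ball x (s / 2)) = - ln \<delta>" for x :: 'a
      using half s by (simp add: content_ball V_def)
    have vol_R: "\<rho> * measure lborel (ball x (R * s)) = \<mu>" for x :: 'a
    proof -
      have "\<rho> * measure lborel (ball x (R * s)) = \<rho> * (V * (s / 2) ^ DIM('a)) * (2 * R) ^ DIM('a)"
        using s R by (simp add: content_ball V_def power_mult_distrib power_divide)
      then show ?thesis by (simp add: half \<mu>_def)
    qed
    define c where "c u = s *\<^sub>R (real (fst u) *\<^sub>R e1 + real (snd u) *\<^sub>R e2)" for u :: "nat \<times> nat"
    have c_diff: "c u - c v = s *\<^sub>R ((real (fst u) - real (fst v)) *\<^sub>R e1 + (real (snd u) - real (snd v)) *\<^sub>R e2)" for u v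
      by (simp add: c_def algebra_simps)
    have c_far: "s * \<bar>real (fst u) - real (fst v)\<bar> \<le> dist (c u) (c v)"
      "s * \<bar>real (snd u) - real (snd v)\<bar> \<le> dist (c u) (c v)" for u v
      using Basis_le_norm[OF e(1), of "c u - c v"] Basis_le_norm[OF e(2), of "c u - c v"] e s
      by (simp_all add: dist_norm c_diff inner_add_left inner_Basis abs_mult)
    have c_sep: "s * t \<le> dist (c u) (c v)"
      if "t \<le> \<bar>real (fst u) - real (fst v)\<bar> \<or> t \<le> \<bar>real (snd u) - real (snd v)\<bar>" for t u v
      using that
    proof
      assume "t \<le> \<bar>real (fst u) - real (fst v)\<bar>"
      from mult_left_mono[OF this, of s] s c_far(1)[of u v] show ?thesis by linarith
    next
      assume "t \<le> \<bar>real (snd u) - real (snd v)\<bar>"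
      from mult_left_mono[OF this, of s] s c_far(2)[of u v] show ?thesis by linarith
    qed
    define Bad where "Bad u = {S \<in> space P. points_in (ball (c u) (s / 2)) S = 0 \<or>
      k \<le> points_in (ball (c u) (R * s)) S}" for u
    show ?thesis
    proof (rule peierls[of Bad])
      show "Bad u \<in> events" for u
      proof -
        have eq: "Bad u = {S \<in> space P. points_in (ball (c u) (s / 2)) S \<in> {0}} \<union>
          {S \<in> space P. points_in (ball (c u) (R * s)) S \<in> {k..}}"
          by (auto simp: Bad_def)
        show ?thesis
          unfolding eq by (intro sets.Un poisson_pred[OF law ball_bounded_borel])
      qed
      show "{S \<in> space P. infinite_component S (GN_edges k \<alpha> S)} \<in> events"
        using sets_P \<alpha> k(1) by (rule infinite_component_measurable)
      show "prob (\<Inter>u\<in>T. Bad u) \<le> (1/36) ^ card T" if T: "finite T" "T \<noteq> {}" for T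
      proof -
        obtain T' where T': "T' \<subseteq> T" "card T \<le> m\<^sup>2 * card T'"
          "\<And>u v. u \<in> T' \<Longrightarrow> v \<in> T' \<Longrightarrow> u \<noteq> v \<Longrightarrow>
            real m \<le> \<bar>real (fst u) - real (fst v)\<bar> \<or> real m \<le> \<bar>real (snd u) - real (snd v)\<bar>"
          using sparse_subset[OF T(1) m(2)] by blast
        have fin': "finite T'" and ne': "T' \<noteq> {}"
          using T T'(1,2) finite_subset by (auto simp: card_gt_0_iff)
        have disj: "disjoint_family_on (\<lambda>u. ball (c u) (R * s)) T'"
          unfolding disjoint_family_on_def
        proof (intro ballI impI)
          fix u v assume uv: "u \<in> T'" "v \<in> T'" "u \<noteq> v"
          have "s * (2 * R) \<le> dist (c u) (c v)"
            by (rule c_sep) (use T'(3)[OF uv] m(1) in linarith)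
          then show "ball (c u) (R * s) \<inter> ball (c v) (R * s) = {}"
            by (intro disjoint_ballI) (simp add: algebra_simps)
        qed
        \<comment> \<open>Dropping sites enlarges the intersection, and the large balls of the
          remaining sites are disjoint.\<close>
        have "prob (\<Inter>u\<in>T. Bad u) \<le> prob (\<Inter>u\<in>T'. Bad u)"
          using T'(1) fin' ne' \<open>\<And>u. Bad u \<in> events\<close>
          by (intro finite_measure_mono INF_superset_mono sets.finite_INT) auto
        also have "\<dots> \<le> (2 * \<delta>) ^ card T'"
          unfolding Bad_def
        proof (rule poisson_empty_or_crowded[OF law fin' ne'])
          show "ball (c u) (s / 2) \<subseteq> ball (c u) (R * s)" for u
            using R s by (intro subset_ball) simp
          show "prob {S \<in> space P. points_in (ball (c u) (s / 2)) S = 0} \<le> \<delta>" for u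
            unfolding poisson_void[OF law ball_bounded_borel] vol using \<delta> by simp
          show "prob {S \<in> space P. k \<le> points_in (ball (c u) (R * s)) S} \<le> \<delta>" for u
            unfolding poisson_tail[OF law ball_bounded_borel] vol_R by (rule k(2))
        qed (use s disj ball_bounded_borel in auto)
        also have "\<dots> = (1/36) ^ (m\<^sup>2 * card T')"
          by (simp add: \<delta>_def power_mult)
        also have "\<dots> \<le> (1/36) ^ card T"
          by (rule power_decreasing[OF T'(2)]) auto
        finally show ?thesis .
      qed
      show "S \<in> {S \<in> space P. infinite_component S (GN_edges k \<alpha> S)}"
        if S: "S \<in> space P" and S0: "S \<notin> Bad (0, 0)"
          and inf: "infinite ((Restr nbr {u. S \<notin> Bad u})\<^sup>* `` {(0, 0)})" for S
      proof -
        have "infinite_component S (GN_edges k \<alpha> S)"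
        proof (rule good_cluster_infinite_component[OF _ \<alpha> k(1) s, where pos = c])
          show "S \<in> configurations" using S space_P by simp
          show "s \<le> dist (c u) (c v)" if "u \<noteq> v" for u v
          proof -
            have "1 \<le> \<bar>real (fst u) - real (fst v)\<bar> \<or> 1 \<le> \<bar>real (snd u) - real (snd v)\<bar>"
              using that by (auto simp: prod_eq_iff)
            from c_sep[OF this] show ?thesis by simp
          qed
          show "dist (c u) (c v) \<le> s" if "(u, v) \<in> nbr" for u v
            using that e s unfolding dist_norm c_diff
            by (auto simp: nbr_def abs_mult)
          show "points_in (ball (c u) (s / 2)) S \<noteq> 0 \<and>
              points_in (ball (c u) ((1/2 + 2/\<alpha>) * s)) S < k" if "u \<in> {u. S \<notin> Bad u}" for u
            using that S by (auto simp: Bad_def R_def)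
          show "(0, 0) \<in> {u. S \<notin> Bad u}" using S0 by simp
          show "infinite ((Restr nbr {u. S \<notin> Bad u})\<^sup>* `` {(0, 0)})" by (rule inf)
        qed
        then show ?thesis using S by simp
      qed
    qed
  qed
  then show ?thesis
    using k(1) unfolding GN_percolates_def by blast
qed

theorem theorem5p3:
  fixes \<alpha> :: real
  assumes "\<alpha> > 0" and "CARD('n::finite) \<ge> 2"
  shows "\<exists>k::nat. k \<ge> 1 \<and> GN_percolates TYPE(real ^ 'n) k \<alpha>"
proof -
  have "DIM(real ^ 'n) \<ge> 2"
    using assms(2) by simp
  from GN_percolates_euclidean_space[OF assms(1) this] show ?thesis
    by blast
qed

end
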